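(* Let $(M;\vee,\wedge,\oplus,0)$ be a strict EMV-algebra. Then $M$ has a top element.
   Context: An EMV-algebra is an algebra $(M;\vee,\wedge,\oplus,0)$ of type $(2,2,2,0)$ such that: (E1) $(M;\vee,\wedge,0)$ is a distributive lattice with least element $0$; (E2) $(M;\oplus,0)$ is a commutative ordered monoid with neutral element $0$; (E3) writing $\mathcal I(M)=\{x\in M\mid x\oplus x=x\}$ (the idempotents), for each $a\in\mathcal I(M)$ and each $x\in[0,a]$ the element $\lambda_a(x)=\min\{z\in[0,a]\mid x\oplus z=a\}$ exists, and $([0,a];\oplus,\lambda_a,0,a)$ is an MV-algebra; (E4) for each $x\in M$ there is $a\in\mathcal I(M)$ with $x\le a$. A top element is not assumed. For $x,y\in M$, $x\odot y:=\lambda_a(\lambda_a(x)\oplus\lambda_a(y))$ for any $a\in\mathcal I(M)$ with $x,y\le a$ (this does not depend on $a$). A square root on $M$ is a map $s:M\to M$ such that (Sq1) $s(x)\odot s(x)=x$ for all $x\in M$; (Sq2) for all $x,y\in M$, $y\odot y\le x$ implies $y\le s(x)$. For $b\in\mathcal I(M)$, $s_b:[0,b]\to[0,b]$, $s_b(x)=s(x)\wedge b$, is a square root on the MV-algebra $[0,b]$. An EMV-algebra $M$ with a square root $s$ is called strict if, for each $b\in\mathcal I(M)$ with $b\ge s(0)$, the MV-algebra $([0,b];\oplus,\lambda_b,0,b)$ with the square root $s_b$ is strict, i.e. $s_b(0)=\lambda_b(s_b(0))$. *)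

theory Defs
  imports Main "HOL-Algebra.Group"
begin

locale mv_algebra =
  fixes A :: "'a set"
    and oplus :: "'a \<Rightarrow> 'a \<Rightarrow> 'a" (infixl "\<oplus>\<^sub>A" 65)
    and neg :: "'a \<Rightarrow> 'a"
    and zero :: 'a ("\<zero>\<^sub>A")
    and one :: 'a ("\<one>\<^sub>A")
  assumes oplus_monoid: "comm_monoid \<lparr>carrier = A, mult = oplus, one = zero\<rparr>"
    and one_closed: "\<one>\<^sub>A \<in> A"
    and neg_closed: "x \<in> A \<Longrightarrow> neg x \<in> A"
    and neg_neg: "x \<in> A \<Longrightarrow> neg (neg x) = x"
    and neg_zero: "neg \<zero>\<^sub>A = \<one>\<^sub>A"
    and oplus_one: "x \<in> A \<Longrightarrow> x \<oplus>\<^sub>A \<one>\<^sub>A = \<one>\<^sub>A"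
    and lukasiewicz:
      "\<lbrakk>x \<in> A; y \<in> A\<rbrakk> \<Longrightarrow> neg (neg x \<oplus>\<^sub>A y) \<oplus>\<^sub>A y = neg (neg y \<oplus>\<^sub>A x) \<oplus>\<^sub>A x"

text \<open>
  For an EMV-algebra the carrier is a whole type, \<open>\<or>\<close> and \<open>\<and>\<close> are \<^const>\<open>sup\<close> and
  \<^const>\<open>inf\<close>, and \<open>\<oplus>\<close> and its neutral element are written \<open>+\<close> and \<open>0\<close>; the order is the
  lattice order. The preliminary class below is (E1) and (E2).
\<close>

class pre_emv_algebra = distrib_lattice + ordered_comm_monoid_add +
  assumes zero_least: "0 \<le> x"
begin

definition idempotents :: "'a set" where
  "idempotents = {x. x + x = x}"

text \<open>
  \<open>lam a x\<close> is \<open>\<lambda>\<^sub>a(x)\<close>. It is meaningful only for idempotent \<open>a\<close> and \<open>x \<le> a\<close>, where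
  (E3) guarantees that the minimum exists.
\<close>

definition lam :: "'a \<Rightarrow> 'a \<Rightarrow> 'a" where
  "lam a x = (LEAST z. z \<in> {0..a} \<and> x + z = a)"

end

class emv_algebra = pre_emv_algebra +
  assumes lam_exists: "\<lbrakk>a \<in> idempotents; x \<in> {0..a}\<rbrakk> \<Longrightarrow>
      \<exists>z \<in> {0..a}. x + z = a \<and> (\<forall>w \<in> {0..a}. x + w = a \<longrightarrow> z \<le> w)"
    and interval_mv: "a \<in> idempotents \<Longrightarrow> mv_algebra {0..a} (+) (lam a) 0 a"
    and idempotent_above: "\<exists>a \<in> idempotents. x \<le> a"
begin

text \<open>
  The value of \<open>x \<odot> y\<close> does not depend on the idempotent \<open>a \<ge> x, y\<close>, so an arbitrary one
  is chosen; one exists by (E4) applied to \<open>sup x y\<close>.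
\<close>

definition odot :: "'a \<Rightarrow> 'a \<Rightarrow> 'a" (infixl "\<odot>" 70) where
  "x \<odot> y = (let a = (SOME a. a \<in> idempotents \<and> x \<le> a \<and> y \<le> a)
            in lam a (lam a x + lam a y))"

definition square_root :: "('a \<Rightarrow> 'a) \<Rightarrow> bool" where
  "square_root s \<longleftrightarrow>
     (\<forall>x. s x \<odot> s x = x) \<and> (\<forall>x y. y \<odot> y \<le> x \<longrightarrow> y \<le> s x)"

text \<open>The map \<open>s\<^sub>b\<close> that a square root \<open>s\<close> induces on the MV-algebra \<open>[0,b]\<close>.\<close>

definition local_root :: "('a \<Rightarrow> 'a) \<Rightarrow> 'a \<Rightarrow> 'a \<Rightarrow> 'a" where
  "local_root s b x = inf (s x) b"

end

text \<open>
  Strictness of an MV-algebra with negation \<open>neg\<close>, least element \<open>zero\<close> and square root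
  \<open>r\<close>.
\<close>

definition mv_strict_root :: "('a \<Rightarrow> 'a) \<Rightarrow> 'a \<Rightarrow> ('a \<Rightarrow> 'a) \<Rightarrow> bool" where
  "mv_strict_root neg zero r \<longleftrightarrow> r zero = neg (r zero)"

definition (in emv_algebra) strict_root :: "('a \<Rightarrow> 'a) \<Rightarrow> bool" where
  "strict_root s \<longleftrightarrow> square_root s \<and>
     (\<forall>b \<in> idempotents. s 0 \<le> b \<longrightarrow> mv_strict_root (lam b) 0 (local_root s b))"

end

theory Submission
  imports Defs
begin

text \<open>
  If \<open>b \<ge> s(0)\<close> is idempotent, strictness says \<open>\<lambda>\<^sub>b(s(0)) = s(0)\<close>, hence \<open>b = s(0) \<oplus> s(0)\<close>. So there
  is only one idempotent above \<open>s(0)\<close>; since every \<open>x \<or> s(0)\<close> lies below an idempotent, it is the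
  top element.
\<close>

context emv_algebra
begin

text \<open>\<open>lam\<close> is a \<open>LEAST\<close>, so it satisfies its defining equation only
  because \<open>lam_exists\<close> supplies an attained minimum.\<close>

lemma add_lam:
  assumes "a \<in> idempotents" and "x \<le> a"
  shows "x + lam a x = a"
proof -
  have "x \<in> {0..a}"
    using assms zero_least by simp
  from lam_exists[OF assms(1) this] obtain z
    where z: "z \<in> {0..a}" "x + z = a" "\<And>w. w \<in> {0..a} \<Longrightarrow> x + w = a \<Longrightarrow> z \<le> w"
    by blast
  have "lam a x = z"
    unfolding lam_def by (rule Least_equality) (use z in auto)
  with z(2) show ?thesis
    by simp
qed

lemma strict_root_idempotent_eq:
  assumes "strict_root s" and "b \<in> idempotents" and "s 0 \<le> b"
  shows "b = s 0 + s 0"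
proof -
  \<comment> \<open>Since \<open>s 0 \<le> b\<close>, the meet with \<open>b\<close> in
    \<open>local_root s b 0\<close> leaves \<open>s 0\<close> unchanged.\<close>
  have "lam b (s 0) = s 0"
    using assms by (simp add: strict_root_def mv_strict_root_def local_root_def inf_absorb1)
  with add_lam[OF assms(2,3)] show ?thesis
    by simp
qed

end

theorem theorem4p2:
  fixes s :: "'a::emv_algebra \<Rightarrow> 'a"
  assumes "strict_root s"
  shows "\<exists>t::'a. \<forall>x. x \<le> t"
proof (intro exI allI)
  fix x :: 'a
  \<comment> \<open>Joining \<open>s 0\<close> to \<open>x\<close> forces \<open>a\<close> above
    \<open>s 0\<close>, so \<open>a\<close> equals \<open>s 0 + s 0\<close> whatever
    \<open>x\<close> is.\<close>
  obtain a where "a \<in> idempotents" "sup x (s 0) \<le> a"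
    using idempotent_above by blast
  with strict_root_idempotent_eq[OF assms] show "x \<le> s 0 + s 0"
    by (metis le_sup_iff)
qed

end
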